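(* Let $\varphi=(G,\mathsf{type},p,q)$ be a pure bloom causal model over a hypergraph $\Sigma$ with no global inputs ($\mathsf{in}(\varphi)=\emptyset$) and in which every box has exactly one output. Then categorical and classical $d$-separation coincide: for all pairwise disjoint sets of output wires $\mathcal{X},\mathcal{Y},\mathcal{Z}\subseteq\mathsf{out}(\varphi)$, $\mathcal{Z}$ categorically $d$-separates $\mathcal{X}$ and $\mathcal{Y}$ if and only if $\mathcal{X}$ is classically $d$-separated from $\mathcal{Y}$ by $\mathcal{Z}$.
   Context: **Hypergraphs and string diagrams.** A hypergraph $G$ consists of a set $W(G)$ of wires and, for all $k,\ell\in\mathbb{N}$, a set $B_{k,\ell}(G)$ of boxes with maps $\mathsf{in}_1,\dots,\mathsf{in}_k,\mathsf{out}_1,\dots,\mathsf{out}_\ell:B_{k,\ell}(G)\to W(G)$; $B(G)=\coprod_{k,\ell} B_{k,\ell}(G)$. Morphisms are maps of wires and of boxes (preserving $(k,\ell)$) commuting with all $\mathsf{in}_i,\mathsf{out}_j$. Write $\mathsf{in}(b,A)$, $\mathsf{out}(b,A)$ for the number of input, resp. output, positions of $b$ attached to wire $A$. A gs-monoidal string diagram over $\Sigma$ is $\varphi=(G,\mathsf{type},p,q)$, with $G$ a finite hypergraph, $\mathsf{type}:G\to\Sigma$ a hypergraph morphism, and functions $p:\{1,\dots,n\}\to W(G)$, $q:\{1,\dots,m\}\to W(G)$ (global inputs and outputs), such that $G$ is acyclic (there are no wires $A_0,\dots,A_{k-1}$ and boxes $f_0,\dots,f_{k-1}$, $k\ge1$,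 with $\mathsf{in}(f_i,A_i)\ge1$ and $\mathsf{out}(f_i,A_{i+1})\ge1$, indices mod $k$) and left monogamous ($|p^{-1}(W)|+\sum_{b\in B(G)}\mathsf{out}(b,W)=1$ for every wire $W$). A box $b$ is eliminable if no output wire of $b$ is in the image of $q$ or an input of any box; $\varphi$ is normalized if it has no eliminable box. The normalization of a diagram is obtained by repeatedly deleting eliminable boxes together with their output wires. A generalized causal model is a normalized gs-monoidal string diagram with $q$ injective; it is pure bloom if $q$ is a bijection onto $W(G)$. Put $\mathsf{in}(\varphi)=p(\{1,\dots,n\})$ and $\mathsf{out}(\varphi)=q(\{1,\dots,m\})$. **Categorical $d$-separation.** For $\mathcal{W}\subseteq\mathsf{out}(\varphi)$, $\varphi_{\mathcal{W}}$ is the normalization of the diagram obtained from $\varphi$ by discarding all outputs not in $\mathcal{W}$ (restricting $q$ to $q^{-1}(\mathcal{W})$). $\mathsf{Cut}_{\mathcal{Z}}(\varphi)$ is obtained by deleting the wires in $\mathcal{Z}$ from the diagram (from all inputs and outputs of boxes and from global inputs and outputs), keeping all boxes. An undirected path between wires $X,Y$ is a sequence of wires $X=W_1,\dots,W_{r+1}=Y$ and boxes $b_1,\dots,b_r$ such that both $W_i$ and $W_{i+1}$ are inputs or outputs of $b_i$ (traversals input-to-input and output-to-output are allowed). For disjoint $\mathcal{X},\mathcal{Y},\mathcal{Z}\subseteq\mathsf{out}(\varphi)$, $\mathcal{Z}$ categorically $d$-separates $\mathcal{X}$ and $\mathcal{Y}$ if $\mathsf{Cut}_{\mathcal{Z}}(\varphi_{\mathcal{X}\cup\mathcal{Y}\cup\mathcal{Z}})$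 has no undirected path between any wire in $\mathcal{X}$ and any wire in $\mathcal{Y}$. **Classical $d$-separation.** For wires $A,B$ write $A\to B$ if some box $b$ has $\mathsf{in}(b,A)\ge1$ and $\mathsf{out}(b,B)\ge1$; this makes $W(G)$ a directed acyclic graph. Let $\twoheadrightarrow$ be the reflexive-transitive closure and $\mathsf{An}(\mathcal{Z})=\{U\in W(G):\exists Z\in\mathcal{Z},\ U\twoheadrightarrow Z\}$. A DAG path is an undirected path in this directed acyclic graph (consecutive wires are related by $\to$ in one direction or the other). A DAG path is $d$-separated by $\mathcal{Z}$ if it contains a chain $W\to Z\to U$ (in either direction of traversal) or a fork $W\leftarrow Z\to U$ with $Z\in\mathcal{Z}$, or it contains a collider $W\to M\leftarrow U$ with $M\notin\mathsf{An}(\mathcal{Z})$. $\mathcal{X}$ is classically $d$-separated from $\mathcal{Y}$ by $\mathcal{Z}$ if every DAG path between every $X\in\mathcal{X}$ and $Y\in\mathcal{Y}$ is $d$-separated by $\mathcal{Z}$. *)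

theory Defs
  imports Main
begin

text \<open>
  A box carries the list of its input wires and the list of its output wires; the boxes with \<open>k\<close>
  inputs and \<open>l\<close> outputs are those whose two lists have lengths \<open>k\<close> and \<open>l\<close>, and the \<open>i\<close>-th
  entry of a list is the value of \<open>in_i\<close> respectively \<open>out_i\<close>. Wires may be repeated in a list.
\<close>

record ('w, 'b) pre_hypergraph =
  wires :: "'w set"
  boxes :: "'b set"
  ins :: "'b \<Rightarrow> 'w list"
  outs :: "'b \<Rightarrow> 'w list"

definition hypergraph :: "('w, 'b, 'm) pre_hypergraph_scheme \<Rightarrow> bool" where
  "hypergraph G \<longleftrightarrow>
     (\<forall>b \<in> boxes G. set (ins G b) \<subseteq> wires G \<and> set (outs G b) \<subseteq> wires G)"

definition finite_hypergraph :: "('w, 'b, 'm) pre_hypergraph_scheme \<Rightarrow> bool" where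
  "finite_hypergraph G \<longleftrightarrow> hypergraph G \<and> finite (wires G) \<and> finite (boxes G)"

definition hypergraph_morphism ::
  "('w, 'b, 'm) pre_hypergraph_scheme \<Rightarrow> ('s, 't, 'n) pre_hypergraph_scheme
     \<Rightarrow> ('w \<Rightarrow> 's) \<Rightarrow> ('b \<Rightarrow> 't) \<Rightarrow> bool" where
  "hypergraph_morphism G H f g \<longleftrightarrow>
     (\<forall>w \<in> wires G. f w \<in> wires H) \<and>
     (\<forall>b \<in> boxes G. g b \<in> boxes H \<and>
        ins H (g b) = map f (ins G b) \<and> outs H (g b) = map f (outs G b))"

definition in_mult :: "('w, 'b, 'm) pre_hypergraph_scheme \<Rightarrow> 'b \<Rightarrow> 'w \<Rightarrow> nat" where
  "in_mult G b A = count_list (ins G b) A"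

definition out_mult :: "('w, 'b, 'm) pre_hypergraph_scheme \<Rightarrow> 'b \<Rightarrow> 'w \<Rightarrow> nat" where
  "out_mult G b A = count_list (outs G b) A"

definition acyclic_hypergraph :: "('w, 'b, 'm) pre_hypergraph_scheme \<Rightarrow> bool" where
  "acyclic_hypergraph G \<longleftrightarrow>
     \<not> (\<exists>(k::nat) A f. k \<ge> 1 \<and>
          (\<forall>i<k. A i \<in> wires G \<and> f i \<in> boxes G \<and>
             in_mult G (f i) (A i) \<ge> 1 \<and> out_mult G (f i) (A ((i + 1) mod k)) \<ge> 1))"

definition undirected_path ::
  "('w, 'b, 'm) pre_hypergraph_scheme \<Rightarrow> 'w \<Rightarrow> 'w \<Rightarrow> 'w list \<Rightarrow> 'b list \<Rightarrow> bool" where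
  "undirected_path G X Y ws bs \<longleftrightarrow>
     length ws = length bs + 1 \<and> hd ws = X \<and> last ws = Y \<and>
     set ws \<subseteq> wires G \<and> set bs \<subseteq> boxes G \<and>
     (\<forall>i < length bs.
        ws ! i \<in> set (ins G (bs ! i)) \<union> set (outs G (bs ! i)) \<and>
        ws ! (i + 1) \<in> set (ins G (bs ! i)) \<union> set (outs G (bs ! i)))"

text \<open>
  The functions \<open>p\<close> and \<open>q\<close> are the lists \<open>ginputs\<close> and \<open>goutputs\<close> of their values.
\<close>

record ('w, 'b, 's, 't) pre_diagram = "('w, 'b) pre_hypergraph" +
  wire_type :: "'w \<Rightarrow> 's"
  box_type :: "'b \<Rightarrow> 't"
  ginputs :: "'w list"
  goutputs :: "'w list"

definition left_monogamous :: "('w, 'b, 's, 't) pre_diagram \<Rightarrow> bool" where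
  "left_monogamous \<phi> \<longleftrightarrow>
     (\<forall>w \<in> wires \<phi>. card {i. i < length (ginputs \<phi>) \<and> ginputs \<phi> ! i = w}
        + (\<Sum>b \<in> boxes \<phi>. out_mult \<phi> b w) = 1)"

definition gs_diagram ::
  "('s, 't) pre_hypergraph \<Rightarrow> ('w, 'b, 's, 't) pre_diagram \<Rightarrow> bool" where
  "gs_diagram \<Sigma> \<phi> \<longleftrightarrow>
     finite_hypergraph \<phi> \<and>
     hypergraph_morphism \<phi> \<Sigma> (wire_type \<phi>) (box_type \<phi>) \<and>
     set (ginputs \<phi>) \<subseteq> wires \<phi> \<and> set (goutputs \<phi>) \<subseteq> wires \<phi> \<and>
     acyclic_hypergraph \<phi> \<and> left_monogamous \<phi>"

definition in_wires :: "('w, 'b, 's, 't) pre_diagram \<Rightarrow> 'w set" where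
  "in_wires \<phi> = set (ginputs \<phi>)"

definition out_wires :: "('w, 'b, 's, 't) pre_diagram \<Rightarrow> 'w set" where
  "out_wires \<phi> = set (goutputs \<phi>)"

definition eliminable :: "('w, 'b, 's, 't) pre_diagram \<Rightarrow> 'b \<Rightarrow> bool" where
  "eliminable \<phi> b \<longleftrightarrow> b \<in> boxes \<phi> \<and>
     (\<forall>A \<in> set (outs \<phi> b). A \<notin> out_wires \<phi> \<and> (\<forall>c \<in> boxes \<phi>. A \<notin> set (ins \<phi> c)))"

definition normalized :: "('w, 'b, 's, 't) pre_diagram \<Rightarrow> bool" where
  "normalized \<phi> \<longleftrightarrow> \<not> (\<exists>b \<in> boxes \<phi>. eliminable \<phi> b)"

definition delete_box ::
  "('w, 'b, 's, 't) pre_diagram \<Rightarrow> 'b \<Rightarrow> ('w, 'b, 's, 't) pre_diagram" where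
  "delete_box \<phi> b =
     \<phi>\<lparr>wires := wires \<phi> - set (outs \<phi> b), boxes := boxes \<phi> - {b}\<rparr>"

definition elim_step ::
  "('w, 'b, 's, 't) pre_diagram \<Rightarrow> ('w, 'b, 's, 't) pre_diagram \<Rightarrow> bool" where
  "elim_step \<phi> \<psi> \<longleftrightarrow> (\<exists>b. eliminable \<phi> b \<and> \<psi> = delete_box \<phi> b)"

text \<open>
  Well defined whenever there are finitely many boxes, see \<open>ex1_normalization\<close> below.
\<close>

definition normalization :: "('w, 'b, 's, 't) pre_diagram \<Rightarrow> ('w, 'b, 's, 't) pre_diagram" where
  "normalization \<phi> = (THE \<psi>. elim_step\<^sup>*\<^sup>* \<phi> \<psi> \<and> normalized \<psi>)"

lemma eliminable_delete_box:
  "eliminable \<phi> b \<Longrightarrow> b \<noteq> c \<Longrightarrow> eliminable (delete_box \<phi> c) b"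
  by (auto simp: eliminable_def delete_box_def out_wires_def)

lemma delete_box_commute:
  "delete_box (delete_box \<phi> b) c = delete_box (delete_box \<phi> c) b"
  by (auto simp: delete_box_def intro!: pre_hypergraph.equality)

lemma elim_step_card:
  assumes "finite (boxes \<phi>)" "elim_step \<phi> \<psi>"
  shows "finite (boxes \<psi>)" "card (boxes \<psi>) < card (boxes \<phi>)"
proof -
  obtain b where b: "b \<in> boxes \<phi>" and \<psi>: "\<psi> = delete_box \<phi> b"
    using assms(2) by (auto simp: elim_step_def eliminable_def)
  have "boxes \<psi> = boxes \<phi> - {b}"
    by (simp add: \<psi> delete_box_def)
  then show "finite (boxes \<psi>)" "card (boxes \<psi>) < card (boxes \<phi>)"
    using assms(1) b card_Diff1_less[OF assms(1) b] by simp_all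
qed

lemma normalized_iff_no_elim_step: "normalized \<phi> \<longleftrightarrow> \<not> (\<exists>\<psi>. elim_step \<phi> \<psi>)"
  by (auto simp: normalized_def elim_step_def eliminable_def)

lemma elim_step_diamond:
  assumes "elim_step \<phi> \<psi>" "elim_step \<phi> \<chi>" "\<psi> \<noteq> \<chi>"
  shows "\<exists>\<rho>. elim_step \<psi> \<rho> \<and> elim_step \<chi> \<rho>"
proof -
  obtain b c where b: "eliminable \<phi> b" "\<psi> = delete_box \<phi> b"
    and c: "eliminable \<phi> c" "\<chi> = delete_box \<phi> c"
    using assms by (auto simp: elim_step_def)
  with assms(3) have "b \<noteq> c" by auto
  then have "eliminable \<psi> c" "eliminable \<chi> b"
    using b c by (simp_all add: eliminable_delete_box)
  then show ?thesis
    using b(2) c(2) delete_box_commute unfolding elim_step_def by metis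
qed

lemma ex1_normalization:
  assumes "finite (boxes \<phi>)"
  shows "\<exists>!\<psi>. elim_step\<^sup>*\<^sup>* \<phi> \<psi> \<and> normalized \<psi>"
  using assms
proof (induction "card (boxes \<phi>)" arbitrary: \<phi> rule: less_induct)
  case less
  show ?case
  proof (cases "normalized \<phi>")
    case True
    then show ?thesis
      by (metis converse_rtranclpE normalized_iff_no_elim_step rtranclp.rtrancl_refl)
  next
    case False
    then obtain \<psi> where step: "elim_step \<phi> \<psi>"
      by (auto simp: normalized_iff_no_elim_step)
    have IH: "\<exists>!\<rho>. elim_step\<^sup>*\<^sup>* \<chi> \<rho> \<and> normalized \<rho>" if "elim_step \<phi> \<chi>" for \<chi>
      using less elim_step_card that by blast
    obtain \<rho> where \<rho>: "elim_step\<^sup>*\<^sup>* \<psi> \<rho>" "normalized \<rho>"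
      using IH[OF step] by blast
    have "\<sigma> = \<rho>" if \<sigma>: "elim_step\<^sup>*\<^sup>* \<phi> \<sigma>" "normalized \<sigma>" for \<sigma>
    proof -
      obtain \<chi> where \<chi>: "elim_step \<phi> \<chi>" "elim_step\<^sup>*\<^sup>* \<chi> \<sigma>"
        using \<sigma> False by (metis converse_rtranclpE)
      show ?thesis
      proof (cases "\<chi> = \<psi>")
        case True
        then show ?thesis using IH[OF step] \<chi> \<sigma> \<rho> by blast
      next
        case False
        then obtain \<tau> where \<tau>: "elim_step \<chi> \<tau>" "elim_step \<psi> \<tau>"
          using elim_step_diamond \<chi>(1) step by blast
        have fin: "finite (boxes \<chi>)" "card (boxes \<chi>) < card (boxes \<phi>)"
          using elim_step_card[OF less.prems \<chi>(1)] by auto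
        have "finite (boxes \<tau>)" "card (boxes \<tau>) < card (boxes \<phi>)"
          using elim_step_card[OF fin(1) \<tau>(1)] fin(2) by auto
        then obtain \<upsilon> where \<upsilon>: "elim_step\<^sup>*\<^sup>* \<tau> \<upsilon>" "normalized \<upsilon>"
          using less.hyps by blast
        have "elim_step\<^sup>*\<^sup>* \<chi> \<upsilon>" "elim_step\<^sup>*\<^sup>* \<psi> \<upsilon>"
          using \<tau> \<upsilon>(1) by (meson converse_rtranclp_into_rtranclp)+
        then show ?thesis
          using IH[OF \<chi>(1)] IH[OF step] \<upsilon>(2) \<sigma>(2) \<rho> \<chi>(2) by blast
      qed
    qed
    moreover have "elim_step\<^sup>*\<^sup>* \<phi> \<rho>"
      using step \<rho>(1) by (rule converse_rtranclp_into_rtranclp)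
    ultimately show ?thesis using \<rho>(2) by blast
  qed
qed

definition causal_model ::
  "('s, 't) pre_hypergraph \<Rightarrow> ('w, 'b, 's, 't) pre_diagram \<Rightarrow> bool" where
  "causal_model \<Sigma> \<phi> \<longleftrightarrow> gs_diagram \<Sigma> \<phi> \<and> normalized \<phi> \<and> distinct (goutputs \<phi>)"

definition pure_bloom ::
  "('s, 't) pre_hypergraph \<Rightarrow> ('w, 'b, 's, 't) pre_diagram \<Rightarrow> bool" where
  "pure_bloom \<Sigma> \<phi> \<longleftrightarrow> causal_model \<Sigma> \<phi> \<and> out_wires \<phi> = wires \<phi>"

definition discard_outputs ::
  "'w set \<Rightarrow> ('w, 'b, 's, 't) pre_diagram \<Rightarrow> ('w, 'b, 's, 't) pre_diagram" where
  "discard_outputs \<W> \<phi> = \<phi>\<lparr>goutputs := filter (\<lambda>w. w \<in> \<W>) (goutputs \<phi>)\<rparr>"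

definition marginal ::
  "('w, 'b, 's, 't) pre_diagram \<Rightarrow> 'w set \<Rightarrow> ('w, 'b, 's, 't) pre_diagram" where
  "marginal \<phi> \<W> = normalization (discard_outputs \<W> \<phi>)"

text \<open>
  Cutting shortens the input and output lists of boxes, so that \<open>box_type\<close>, which is left as it
  is, need not be part of a hypergraph morphism afterwards.
\<close>

definition cut ::
  "'w set \<Rightarrow> ('w, 'b, 's, 't) pre_diagram \<Rightarrow> ('w, 'b, 's, 't) pre_diagram" where
  "cut \<Z> \<phi> = \<phi>\<lparr>
     wires := wires \<phi> - \<Z>,
     ins := (\<lambda>b. filter (\<lambda>w. w \<notin> \<Z>) (ins \<phi> b)),
     outs := (\<lambda>b. filter (\<lambda>w. w \<notin> \<Z>) (outs \<phi> b)),
     ginputs := filter (\<lambda>w. w \<notin> \<Z>) (ginputs \<phi>),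
     goutputs := filter (\<lambda>w. w \<notin> \<Z>) (goutputs \<phi>)\<rparr>"

definition cat_d_separates ::
  "('w, 'b, 's, 't) pre_diagram \<Rightarrow> 'w set \<Rightarrow> 'w set \<Rightarrow> 'w set \<Rightarrow> bool" where
  "cat_d_separates \<phi> \<Z> \<X> \<Y> \<longleftrightarrow>
     (\<forall>X \<in> \<X>. \<forall>Y \<in> \<Y>.
        \<not> (\<exists>ws bs. undirected_path (cut \<Z> (marginal \<phi> (\<X> \<union> \<Y> \<union> \<Z>))) X Y ws bs))"

definition wire_edge :: "('w, 'b, 'm) pre_hypergraph_scheme \<Rightarrow> 'w \<Rightarrow> 'w \<Rightarrow> bool" where
  "wire_edge G A B \<longleftrightarrow> (\<exists>b \<in> boxes G. in_mult G b A \<ge> 1 \<and> out_mult G b B \<ge> 1)"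

definition ancestors :: "('w, 'b, 'm) pre_hypergraph_scheme \<Rightarrow> 'w set \<Rightarrow> 'w set" where
  "ancestors G \<Z> = {U \<in> wires G. \<exists>Z \<in> \<Z>. (wire_edge G)\<^sup>*\<^sup>* U Z}"

text \<open>As for undirected paths in hypergraphs, wires may repeat along a path.\<close>

definition dag_path ::
  "('w, 'b, 'm) pre_hypergraph_scheme \<Rightarrow> 'w \<Rightarrow> 'w \<Rightarrow> 'w list \<Rightarrow> bool" where
  "dag_path G X Y ws \<longleftrightarrow>
     ws \<noteq> [] \<and> hd ws = X \<and> last ws = Y \<and> set ws \<subseteq> wires G \<and>
     (\<forall>i. i + 1 < length ws \<longrightarrow>
        wire_edge G (ws ! i) (ws ! (i + 1)) \<or> wire_edge G (ws ! (i + 1)) (ws ! i))"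

definition path_d_separated ::
  "('w, 'b, 'm) pre_hypergraph_scheme \<Rightarrow> 'w set \<Rightarrow> 'w list \<Rightarrow> bool" where
  "path_d_separated G \<Z> ws \<longleftrightarrow>
     (\<exists>i. i + 2 < length ws \<and>
        (let W = ws ! i; M = ws ! (i + 1); U = ws ! (i + 2) in
           (wire_edge G W M \<and> wire_edge G M U \<and> M \<in> \<Z>) \<or>
           (wire_edge G U M \<and> wire_edge G M W \<and> M \<in> \<Z>) \<or>
           (wire_edge G M W \<and> wire_edge G M U \<and> M \<in> \<Z>) \<or>
           (wire_edge G W M \<and> wire_edge G U M \<and> M \<notin> ancestors G \<Z>)))"

definition classical_d_separated ::
  "('w, 'b, 'm) pre_hypergraph_scheme \<Rightarrow> 'w set \<Rightarrow> 'w set \<Rightarrow> 'w set \<Rightarrow> bool" where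
  "classical_d_separated G \<X> \<Y> \<Z> \<longleftrightarrow>
     (\<forall>X \<in> \<X>. \<forall>Y \<in> \<Y>. \<forall>ws. dag_path G X Y ws \<longrightarrow> path_d_separated G \<Z> ws)"

end

theory Submission
  imports Defs
begin

text \<open>
  With one output per box and no global inputs, boxes correspond to wires, and the normalized
  marginal on \<open>\<S> = \<X> \<union> \<Y> \<union> \<Z>\<close> keeps exactly the wires in \<open>An(\<S>)\<close> together with the boxes
  producing them. Undirected paths after cutting \<open>\<Z>\<close> are therefore walks in the moral graph of
  \<open>An(\<S>)\<close> that avoid \<open>\<Z>\<close>. A walk that is not d-separated stays in \<open>An(\<S>)\<close> and gives such a moral
  walk by skipping its colliders in \<open>\<Z>\<close>. Conversely, a moral walk is traversed backwards from \<open>\<Y>\<close>.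
  When this creates a collider \<open>M\<close> outside \<open>An(\<Z>)\<close>, then \<open>M\<close> has a directed path avoiding \<open>\<Z>\<close>
  either to \<open>\<X>\<close>, which completes an active walk, or to \<open>\<Y>\<close>, from where the walk is restarted.
\<close>

section \<open>Undirected paths as reachability\<close>

lemma undirected_path_single:
  "undirected_path G X Y [w] [] \<longleftrightarrow> w = X \<and> w = Y \<and> w \<in> wires G"
  by (auto simp: undirected_path_def)

lemma undirected_path_Cons:
  "undirected_path G X Y (w # ws) (b # bs) \<longleftrightarrow>
     w = X \<and> w \<in> wires G \<and> b \<in> boxes G \<and>
     w \<in> set (ins G b) \<union> set (outs G b) \<and> hd ws \<in> set (ins G b) \<union> set (outs G b) \<and>
     undirected_path G (hd ws) Y ws bs"
  by (cases ws) (auto simp: undirected_path_def less_Suc_eq_0_disj)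

definition box_adjacent :: "('w, 'b, 'm) pre_hypergraph_scheme \<Rightarrow> 'w \<Rightarrow> 'w \<Rightarrow> bool" where
  "box_adjacent G v u \<longleftrightarrow> v \<in> wires G \<and> u \<in> wires G \<and>
     (\<exists>b \<in> boxes G. {v, u} \<subseteq> set (ins G b) \<union> set (outs G b))"

text \<open>The boxes along a path can be chosen one step at a time, so only adjacency of
  consecutive wires matters. The conjunct \<open>X \<in> wires G\<close> is for the trivial path:
  the reflexive closure relates any \<open>X\<close> to itself, even outside
  \<open>G\<close>.\<close>

lemma ex_undirected_path_iff:
  "(\<exists>ws bs. undirected_path G X Y ws bs) \<longleftrightarrow> X \<in> wires G \<and> (box_adjacent G)\<^sup>*\<^sup>* X Y"
proof
  assume "\<exists>ws bs. undirected_path G X Y ws bs"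
  then obtain ws bs where "undirected_path G X Y ws bs" by blast
  then show "X \<in> wires G \<and> (box_adjacent G)\<^sup>*\<^sup>* X Y"
  proof (induction bs arbitrary: X ws)
    case Nil
    then obtain w where "ws = [w]"
      by (auto simp: undirected_path_def length_Suc_conv)
    with Nil show ?case by (auto simp: undirected_path_single)
  next
    case (Cons b bs)
    then obtain w ws' where ws: "ws = w # ws'"
      by (cases ws) (auto simp: undirected_path_def)
    with Cons.prems have path: "undirected_path G (hd ws') Y ws' bs"
      by (simp add: undirected_path_Cons)
    from Cons.IH[OF path] have "hd ws' \<in> wires G" "(box_adjacent G)\<^sup>*\<^sup>* (hd ws') Y"
      by auto
    moreover from Cons.prems ws \<open>hd ws' \<in> wires G\<close> have "box_adjacent G X (hd ws')" "X \<in> wires G"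
      by (auto simp: undirected_path_Cons box_adjacent_def)
    ultimately show ?case by (meson converse_rtranclp_into_rtranclp)
  qed
next
  assume "X \<in> wires G \<and> (box_adjacent G)\<^sup>*\<^sup>* X Y"
  then have "(box_adjacent G)\<^sup>*\<^sup>* X Y" "X \<in> wires G" by auto
  then show "\<exists>ws bs. undirected_path G X Y ws bs"
  proof (induction rule: converse_rtranclp_induct)
    case base
    then have "undirected_path G Y Y [Y] []" by (simp add: undirected_path_single)
    then show ?case by blast
  next
    case (step v u)
    then obtain ws bs where path: "undirected_path G u Y ws bs"
      by (auto simp: box_adjacent_def)
    from step(1) obtain b where "b \<in> boxes G" "{v, u} \<subseteq> set (ins G b) \<union> set (outs G b)"
      by (auto simp: box_adjacent_def)
    moreover have "hd ws = u" using path by (simp add: undirected_path_def)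
    ultimately have "undirected_path G v Y (v # ws) (b # bs)"
      using path step.prems by (simp add: undirected_path_Cons)
    then show ?case by blast
  qed
qed

section \<open>Recursive description of unblocked walks\<close>

definition separated_triple ::
  "('w, 'b, 'm) pre_hypergraph_scheme \<Rightarrow> 'w set \<Rightarrow> 'w \<Rightarrow> 'w \<Rightarrow> 'w \<Rightarrow> bool" where
  "separated_triple G \<Z> W M U \<longleftrightarrow>
     (wire_edge G W M \<and> wire_edge G M U \<and> M \<in> \<Z>) \<or>
     (wire_edge G U M \<and> wire_edge G M W \<and> M \<in> \<Z>) \<or>
     (wire_edge G M W \<and> wire_edge G M U \<and> M \<in> \<Z>) \<or>
     (wire_edge G W M \<and> wire_edge G U M \<and> M \<notin> ancestors G \<Z>)"

lemma path_d_separated_short [simp]: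
  "\<not> path_d_separated G \<Z> [v]" "\<not> path_d_separated G \<Z> [v, u]"
  by (auto simp: path_d_separated_def)

lemma path_d_separated_Cons [simp]:
  "path_d_separated G \<Z> (W # M # U # ws) \<longleftrightarrow>
     separated_triple G \<Z> W M U \<or> path_d_separated G \<Z> (M # U # ws)"
  (is "?L \<longleftrightarrow> ?R")
proof -
  have eq: "path_d_separated G \<Z> vs \<longleftrightarrow>
      (\<exists>i. i + 2 < length vs \<and> separated_triple G \<Z> (vs ! i) (vs ! (i + 1)) (vs ! (i + 2)))" for vs
    by (simp add: path_d_separated_def separated_triple_def Let_def)
  \<comment> \<open>Index \<open>0\<close> gives the triple at the head, successor indices give the
    triples of the tail.\<close>
  have "(\<exists>i. P i) \<longleftrightarrow> P 0 \<or> (\<exists>i. P (Suc i))" for P :: "nat \<Rightarrow> bool"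
    by (metis not0_implies_Suc)
  from this[of "\<lambda>i. i + 2 < length (W # M # U # ws) \<and>
      separated_triple G \<Z> ((W # M # U # ws) ! i) ((W # M # U # ws) ! (i + 1)) ((W # M # U # ws) ! (i + 2))"]
  show ?thesis unfolding eq by simp
qed

text \<open>These are the d-connecting walks of graphical models. Wires may repeat, so a walk can be
  extended without a freshness check.\<close>

definition active ::
  "('w, 'b, 'm) pre_hypergraph_scheme \<Rightarrow> 'w set \<Rightarrow> 'w \<Rightarrow> 'w \<Rightarrow> 'w list \<Rightarrow> bool" where
  "active G \<Z> X Y ws \<longleftrightarrow> dag_path G X Y ws \<and> \<not> path_d_separated G \<Z> ws"

lemma active_Nil [simp]: "\<not> active G \<Z> X Y []"
  by (simp add: active_def dag_path_def)

lemma active_single [simp]: "active G \<Z> X Y [w] \<longleftrightarrow> w = X \<and> w = Y \<and> w \<in> wires G"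
  by (auto simp: active_def dag_path_def)

lemma active_hd: "active G \<Z> X Y (w # ws) \<Longrightarrow> w = X"
  by (simp add: active_def dag_path_def)

lemma active_obtain:
  assumes "active G \<Z> X Y ws"
  obtains us where "ws = X # us"
  using assms by (cases ws) (auto dest: active_hd)

lemma dag_path_Cons:
  "dag_path G X Y (v # u # ws) \<longleftrightarrow>
     v = X \<and> v \<in> wires G \<and> (wire_edge G v u \<or> wire_edge G u v) \<and> dag_path G u Y (u # ws)"
proof -
  have "(\<forall>i. P i) \<longleftrightarrow> P 0 \<and> (\<forall>i. P (Suc i))" for P :: "nat \<Rightarrow> bool"
    by (metis not0_implies_Suc)
  from this[of "\<lambda>i. i + 1 < length (v # u # ws) \<longrightarrow>
        wire_edge G ((v # u # ws) ! i) ((v # u # ws) ! (i + 1)) \<or>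
        wire_edge G ((v # u # ws) ! (i + 1)) ((v # u # ws) ! i)"]
  show ?thesis unfolding dag_path_def by auto
qed

text \<open>Prepending \<open>v\<close> creates one new triple, centred at \<open>u\<close>; the
  guard \<open>ws \<noteq> []\<close> is there because a walk of two wires has no triple.\<close>

lemma active_Cons:
  "active G \<Z> X Y (v # u # ws) \<longleftrightarrow>
     v = X \<and> v \<in> wires G \<and> (wire_edge G v u \<or> wire_edge G u v) \<and> active G \<Z> u Y (u # ws) \<and>
     (ws \<noteq> [] \<longrightarrow> \<not> separated_triple G \<Z> v u (hd ws))"
  by (cases ws) (auto simp: active_def dag_path_Cons)

lemma tranclp_wire_edge_irrefl:
  assumes "acyclic_hypergraph G" "hypergraph G"
  shows "\<not> (wire_edge G)\<^sup>+\<^sup>+ w w"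
proof
  assume "(wire_edge G)\<^sup>+\<^sup>+ w w"
  then obtain n where n: "n > 0" "(wire_edge G ^^ n) w w"
    by (auto simp: tranclp_power)
  then obtain A where A: "A 0 = w" "A n = w" "\<forall>i<n. wire_edge G (A i) (A (Suc i))"
    by (auto simp: relpowp_fun_conv)
  then obtain f where f: "\<forall>i<n. f i \<in> boxes G \<and> in_mult G (f i) (A i) \<ge> 1 \<and>
      out_mult G (f i) (A (Suc i)) \<ge> 1"
    unfolding wire_edge_def by metis
  have "A i \<in> wires G" if "i < n" for i
  proof -
    have "A i \<in> set (ins G (f i))"
      using f that by (metis count_notin in_mult_def not_one_le_zero)
    then show ?thesis using f that assms(2) by (auto simp: hypergraph_def)
  qed
  \<comment> \<open>Reduction modulo \<open>n\<close> only replaces the index \<open>n\<close> by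
    \<open>0\<close>, where \<open>A\<close> has the same value \<open>w\<close>.\<close>
  moreover have "A ((i + 1) mod n) = A (Suc i)" if "i < n" for i
    using that A by (cases "Suc i = n") auto
  ultimately show False
    using assms(1) n(1) f unfolding acyclic_hypergraph_def by (metis One_nat_def Suc_leI)
qed

section \<open>Models with single-output boxes\<close>

locale single_output_model =
  fixes \<phi> :: "('w, 'b, 's, 't) pre_diagram"
  assumes finite: "finite_hypergraph \<phi>"
    and acyclic: "acyclic_hypergraph \<phi>"
    and single_output: "b \<in> boxes \<phi> \<Longrightarrow> length (outs \<phi> b) = 1"
    and unique_producer: "w \<in> wires \<phi> \<Longrightarrow> \<exists>!b. b \<in> boxes \<phi> \<and> w \<in> set (outs \<phi> b)"
    and out_wires_eq: "out_wires \<phi> = wires \<phi>"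
begin

abbreviation edge :: "'w \<Rightarrow> 'w \<Rightarrow> bool" (infix "\<leadsto>" 50) where
  "v \<leadsto> u \<equiv> wire_edge \<phi> v u"

abbreviation An :: "'w set \<Rightarrow> 'w set" where
  "An \<equiv> ancestors \<phi>"

lemma edge_iff: "v \<leadsto> u \<longleftrightarrow> (\<exists>b \<in> boxes \<phi>. v \<in> set (ins \<phi> b) \<and> outs \<phi> b = [u])"
proof -
  have mult: "count_list xs x \<ge> Suc 0 \<longleftrightarrow> x \<in> set xs" for xs and x :: 'w
    by (metis count_list_0_iff leI not_less_eq_eq zero_less_iff_neq_zero le_zero_eq Suc_le_eq)
  have "b \<in> boxes \<phi> \<Longrightarrow> u \<in> set (outs \<phi> b) \<longleftrightarrow> outs \<phi> b = [u]" for b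
    using single_output[of b] by (auto simp: length_Suc_conv)
  then show ?thesis
    by (auto simp: wire_edge_def in_mult_def out_mult_def mult)
qed

lemma box_output:
  assumes "b \<in> boxes \<phi>"
  obtains w where "outs \<phi> b = [w]" "w \<in> wires \<phi>"
proof -
  obtain w where w: "outs \<phi> b = [w]"
    using single_output[OF assms] by (auto simp: length_Suc_conv)
  moreover have "w \<in> wires \<phi>"
    using finite assms w by (force simp: finite_hypergraph_def hypergraph_def)
  ultimately show thesis using that by blast
qed

lemma wire_producer:
  assumes "w \<in> wires \<phi>"
  obtains b where "b \<in> boxes \<phi>" "outs \<phi> b = [w]"
proof -
  obtain b where "b \<in> boxes \<phi>" "w \<in> set (outs \<phi> b)"
    using unique_producer[OF assms] by blast
  moreover from this have "outs \<phi> b = [w]"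
    by (auto elim: box_output)
  ultimately show thesis using that by blast
qed

lemma producer_unique:
  assumes "b \<in> boxes \<phi>" "c \<in> boxes \<phi>" "outs \<phi> b = [w]" "outs \<phi> c = [w]"
  shows "b = c"
proof -
  have "w \<in> wires \<phi>" using assms by (auto elim: box_output)
  from unique_producer[OF this] assms show ?thesis by (metis list.set_intros(1))
qed

lemma edge_wires: "v \<leadsto> u \<Longrightarrow> v \<in> wires \<phi>" "v \<leadsto> u \<Longrightarrow> u \<in> wires \<phi>"
  using finite by (force simp: edge_iff finite_hypergraph_def hypergraph_def)+

lemma edge_irrefl: "\<not> edge\<^sup>+\<^sup>+ w w"
  using acyclic finite by (intro tranclp_wire_edge_irrefl) (auto simp: finite_hypergraph_def)

lemma edge_asym: "v \<leadsto> u \<Longrightarrow> \<not> u \<leadsto> v"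
  by (metis edge_irrefl tranclp.r_into_trancl tranclp_trans)

text \<open>In this orientation children are the smaller elements, so an induction passes from the
  wires that \<open>v\<close> feeds to \<open>v\<close> itself.\<close>

lemma wfp_descendants: "wfp (\<lambda>u v. v \<leadsto> u)"
proof -
  let ?R = "{(v, u). v \<leadsto> u}"
  have "?R \<subseteq> wires \<phi> \<times> wires \<phi>" by (auto dest: edge_wires)
  then have "Finite_Set.finite ?R"
    using finite by (auto simp: finite_hypergraph_def intro: finite_subset)
  moreover have "acyclic ?R"
    using edge_irrefl by (simp add: acyclic_def tranclp_def[symmetric] tranclp_unfold)
  ultimately have "wf (?R\<inverse>)" by (rule finite_acyclic_wf_converse)
  then show ?thesis by (simp add: wfp_def converse_unfold)
qed

lemma An_wires: "w \<in> An \<S> \<Longrightarrow> w \<in> wires \<phi>"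
  by (simp add: ancestors_def)

lemma An_base: "w \<in> \<S> \<Longrightarrow> w \<in> wires \<phi> \<Longrightarrow> w \<in> An \<S>"
  by (auto simp: ancestors_def)

lemma An_edge: "v \<leadsto> u \<Longrightarrow> u \<in> An \<S> \<Longrightarrow> v \<in> An \<S>"
  by (auto simp: ancestors_def edge_wires intro: converse_rtranclp_into_rtranclp)

lemma An_mono: "\<S> \<subseteq> \<T> \<Longrightarrow> An \<S> \<subseteq> An \<T>"
  by (auto simp: ancestors_def)

text \<open>The two alternatives match the two ways in which a wire keeps its box from being
  \<open>eliminable\<close>: as a global output or as an input of another box.\<close>

lemma An_cases:
  assumes "w \<in> An \<S>"
  obtains "w \<in> \<S>" | u where "w \<leadsto> u" "u \<in> An \<S>"
proof -
  from assms obtain s where s: "s \<in> \<S>" "edge\<^sup>*\<^sup>* w s" by (auto simp: ancestors_def)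
  from s(2) show thesis
    by (cases rule: converse_rtranclpE)
      (use s that edge_wires in \<open>auto simp: ancestors_def\<close>)
qed

section \<open>Computing the normalized marginal\<close>

text \<open>Elimination never removes a box whose output \<open>w\<close> lies in
  \<open>An \<S>\<close>: either \<open>w\<close> is still a global output, or it feeds a box with
  output in \<open>An \<S>\<close>, which by the invariant is still present.\<close>

lemma marginal_invariant:
  assumes "elim_step\<^sup>*\<^sup>* (discard_outputs \<S> \<phi>) \<psi>"
  shows "ins \<psi> = ins \<phi> \<and> outs \<psi> = outs \<phi> \<and> out_wires \<psi> = wires \<phi> \<inter> \<S> \<and>
    boxes \<psi> \<subseteq> boxes \<phi> \<and> {b \<in> boxes \<phi>. set (outs \<phi> b) \<subseteq> An \<S>} \<subseteq> boxes \<psi> \<and>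
    wires \<psi> = (\<Union>b \<in> boxes \<psi>. set (outs \<phi> b))"
  using assms
proof (induction rule: rtranclp_induct)
  case base
  have "wires \<phi> = (\<Union>b \<in> boxes \<phi>. set (outs \<phi> b))"
    by (auto elim: box_output) (metis list.set_intros(1) wire_producer)
  then show ?case
    using out_wires_eq by (auto simp: discard_outputs_def out_wires_def)
next
  case (step \<psi> \<chi>)
  note IH = step.IH
  from step(2) obtain b where b: "eliminable \<psi> b" and \<chi>: "\<chi> = delete_box \<psi> b"
    by (auto simp: elim_step_def)
  have b\<phi>: "b \<in> boxes \<phi>" using b IH by (auto simp: eliminable_def)
  then obtain w where w: "outs \<phi> b = [w]" "w \<in> wires \<phi>" by (rule box_output)
  have "w \<notin> An \<S>"
  proof
    assume "w \<in> An \<S>"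
    then show False
    proof (cases rule: An_cases)
      case 1
      then show False using b w IH by (auto simp: eliminable_def)
    next
      case (2 u)
      then obtain c where "c \<in> boxes \<phi>" "w \<in> set (ins \<phi> c)" "outs \<phi> c = [u]"
        by (auto simp: edge_iff)
      then show False using 2 b w IH by (auto simp: eliminable_def)
    qed
  qed
  \<comment> \<open>Since \<open>w\<close> has only one producer, deleting it takes no output away
    from the remaining boxes.\<close>
  moreover have "(\<Union>c \<in> boxes \<psi>. set (outs \<phi> c)) - {w} = (\<Union>c \<in> boxes \<psi> - {b}. set (outs \<phi> c))"
  proof -
    have "w \<notin> set (outs \<phi> c)" if "c \<in> boxes \<psi>" "c \<noteq> b" for c
    proof
      assume "w \<in> set (outs \<phi> c)"
      moreover have "c \<in> boxes \<phi>" using that IH by auto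
      ultimately have "outs \<phi> c = [w]" by (auto elim: box_output)
      then show False using producer_unique \<open>c \<in> boxes \<phi>\<close> b\<phi> w that by blast
    qed
    then show ?thesis using w by auto
  qed
  ultimately show ?case
    using IH w by (auto simp: \<chi> delete_box_def out_wires_def)
qed

lemma marginal_facts:
  shows "ins (marginal \<phi> \<S>) = ins \<phi>" "outs (marginal \<phi> \<S>) = outs \<phi>"
    and "boxes (marginal \<phi> \<S>) = {b \<in> boxes \<phi>. set (outs \<phi> b) \<subseteq> An \<S>}"
    and "wires (marginal \<phi> \<S>) = An \<S>"
proof -
  let ?M = "marginal \<phi> \<S>"
  have "Finite_Set.finite (boxes (discard_outputs \<S> \<phi>))"
    using finite by (simp add: discard_outputs_def finite_hypergraph_def)
  from theI'[OF ex1_normalization[OF this]]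
  have steps: "elim_step\<^sup>*\<^sup>* (discard_outputs \<S> \<phi>) ?M" and norm: "normalized ?M"
    by (simp_all add: marginal_def normalization_def)
  note inv = marginal_invariant[OF steps]
  show "ins ?M = ins \<phi>" "outs ?M = outs \<phi>" using inv by auto
  \<comment> \<open>This is the upper bound missing from the invariant. In the normal form the
    output of a box lies in \<open>\<S>\<close> or feeds a remaining box, whose own output is an
    ancestor by induction over descendants.\<close>
  have anc: "w \<in> An \<S>" if "b \<in> boxes ?M" "outs \<phi> b = [w]" for b w
    using that
  proof (induction w arbitrary: b rule: wfp_induct_rule[OF wfp_descendants])
    case (1 w)
    have "b \<in> boxes \<phi>" using 1 inv by auto
    then have wire: "w \<in> wires \<phi>" using 1 by (auto elim: box_output)
    from norm 1 inv have "w \<in> \<S> \<or> (\<exists>c \<in> boxes ?M. w \<in> set (ins \<phi> c))"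
      by (auto simp: normalized_def eliminable_def)
    then show ?case
    proof
      assume "w \<in> \<S>"
      then show ?thesis using wire by (rule An_base)
    next
      assume "\<exists>c \<in> boxes ?M. w \<in> set (ins \<phi> c)"
      then obtain c where c: "c \<in> boxes ?M" "w \<in> set (ins \<phi> c)" by blast
      then have "c \<in> boxes \<phi>" using inv by auto
      then obtain u where u: "outs \<phi> c = [u]" by (rule box_output)
      then have "w \<leadsto> u" using c \<open>c \<in> boxes \<phi>\<close> by (auto simp: edge_iff)
      with 1(1)[OF this c(1) u] show ?thesis by (blast intro: An_edge)
    qed
  qed
  show boxes: "boxes ?M = {b \<in> boxes \<phi>. set (outs \<phi> b) \<subseteq> An \<S>}"
    using inv anc by (force elim: box_output)
  have "\<exists>b \<in> boxes ?M. w \<in> set (outs \<phi> b)" if "w \<in> An \<S>" for w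
  proof -
    obtain b where "b \<in> boxes \<phi>" "outs \<phi> b = [w]"
      using An_wires[OF \<open>w \<in> An \<S>\<close>] by (rule wire_producer)
    then show ?thesis using that unfolding boxes by auto
  qed
  then show "wires ?M = An \<S>" using inv boxes by auto
qed

section \<open>The moral graph\<close>

text \<open>This is the moral graph of \<open>An \<S>\<close> (with loops) restricted to the
  complement of \<open>\<Z>\<close>. The common wire \<open>w\<close> may lie in
  \<open>\<Z>\<close>, because cutting deletes wires but keeps boxes.\<close>

definition moral :: "'w set \<Rightarrow> 'w set \<Rightarrow> 'w \<Rightarrow> 'w \<Rightarrow> bool" where
  "moral \<S> \<Z> v u \<longleftrightarrow> v \<in> An \<S> - \<Z> \<and> u \<in> An \<S> - \<Z> \<and>
     (\<exists>w \<in> An \<S>. (v = w \<or> v \<leadsto> w) \<and> (u = w \<or> u \<leadsto> w))"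

lemma box_adjacent_cut_marginal: "box_adjacent (cut \<Z> (marginal \<phi> \<S>)) = moral \<S> \<Z>"
proof (intro ext)
  fix v u
  have "(\<exists>b \<in> boxes \<phi>. set (outs \<phi> b) \<subseteq> An \<S> \<and> {v, u} \<subseteq> set (ins \<phi> b) \<union> set (outs \<phi> b)) \<longleftrightarrow>
    (\<exists>w \<in> An \<S>. (v = w \<or> v \<leadsto> w) \<and> (u = w \<or> u \<leadsto> w))" (is "?L \<longleftrightarrow> ?R")
  proof
    assume ?L
    then obtain b where b: "b \<in> boxes \<phi>" "set (outs \<phi> b) \<subseteq> An \<S>"
      "{v, u} \<subseteq> set (ins \<phi> b) \<union> set (outs \<phi> b)" by blast
    obtain w where "outs \<phi> b = [w]" using b(1) by (rule box_output)
    then show ?R using b by (intro bexI[of _ w]) (auto simp: edge_iff)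
  next
    assume ?R
    then obtain w where w: "w \<in> An \<S>" "v = w \<or> v \<leadsto> w" "u = w \<or> u \<leadsto> w" by blast
    obtain b where b: "b \<in> boxes \<phi>" "outs \<phi> b = [w]"
      using An_wires[OF w(1)] by (rule wire_producer)
    \<comment> \<open>An edge into \<open>w\<close> could come from any box with output
      \<open>w\<close>, but \<open>b\<close> is the only such box.\<close>
    have "x \<in> set (ins \<phi> b)" if "x \<leadsto> w" for x
      using that b producer_unique by (auto simp: edge_iff)
    then show ?L using b w by (intro bexI[of _ b]) auto
  qed
  then show "box_adjacent (cut \<Z> (marginal \<phi> \<S>)) v u = moral \<S> \<Z> v u"
    by (auto simp: box_adjacent_def moral_def cut_def marginal_facts)
qed

lemma cat_d_separates_iff:
  "cat_d_separates \<phi> \<Z> \<X> \<Y> \<longleftrightarrow>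
     (\<forall>x \<in> \<X>. \<forall>y \<in> \<Y>. \<not> (x \<in> An (\<X> \<union> \<Y> \<union> \<Z>) - \<Z> \<and> (moral (\<X> \<union> \<Y> \<union> \<Z>) \<Z>)\<^sup>*\<^sup>* x y))"
  unfolding cat_d_separates_def ex_undirected_path_iff box_adjacent_cut_marginal
  by (simp add: cut_def marginal_facts)

section \<open>From moral walks to active walks\<close>

text \<open>This is the condition for prepending a parent of the first wire: an outgoing edge would
  continue a chain through \<open>v\<close>, an incoming one would make \<open>v\<close> a
  collider.\<close>

fun open_start :: "'w set \<Rightarrow> 'w list \<Rightarrow> bool" where
  "open_start \<Z> (v # u # ws) \<longleftrightarrow> v \<leadsto> u \<and> v \<notin> \<Z> \<or> u \<leadsto> v \<and> v \<in> An \<Z>"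
| "open_start \<Z> ws \<longleftrightarrow> True"

text \<open>The edge to the new wire leaves \<open>v\<close>, so \<open>v\<close> becomes the middle
  of a chain or a fork, which only \<open>v \<in> \<Z>\<close> could block.\<close>

lemma active_child:
  assumes "active \<phi> \<Z> v y ws" "v \<leadsto> u" "v \<notin> \<Z>"
  shows "active \<phi> \<Z> u y (u # ws)"
proof -
  obtain us where "ws = v # us" using assms(1) by (rule active_obtain)
  then show ?thesis
    using assms edge_wires edge_asym
    by (cases us) (auto simp: active_Cons separated_triple_def)
qed

lemma active_parent:
  assumes "active \<phi> \<Z> v y ws" "u \<leadsto> v" "open_start \<Z> ws"
  shows "active \<phi> \<Z> u y (u # ws)"
proof -
  obtain us where ws: "ws = v # us" using assms(1) by (rule active_obtain)
  show ?thesis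
    using ws assms edge_wires edge_asym
    by (cases us) (auto simp: active_Cons separated_triple_def)
qed

lemma open_start_parent:
  "active \<phi> \<Z> v y ws \<Longrightarrow> u \<leadsto> v \<Longrightarrow> u \<notin> \<Z> \<Longrightarrow> open_start \<Z> (u # ws)"
  by (erule active_obtain) simp

text \<open>The directed path from \<open>v\<close> to \<open>x\<close> is prepended wire by wire.
  It never meets \<open>\<Z>\<close>, as otherwise \<open>v\<close> would be in
  \<open>An \<Z>\<close>.\<close>

lemma active_descend:
  assumes "edge\<^sup>*\<^sup>* v x" "v \<notin> An \<Z>" "active \<phi> \<Z> v y ws"
  shows "\<exists>ws. active \<phi> \<Z> x y ws"
  using assms(1)
proof (induction rule: rtranclp_induct)
  case base
  then show ?case using assms by blast
next
  case (step u x)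
  have "v \<in> wires \<phi>"
    using assms(3) by (cases ws) (auto simp: active_def dag_path_def)
  then have "u \<notin> \<Z>" using step(1) assms(2) by (auto simp: ancestors_def)
  then show ?case using step active_child by blast
qed

text \<open>The walk is the directed path itself, built backwards from \<open>y\<close>; it avoids
  \<open>\<Z>\<close> because \<open>v \<notin> An \<Z>\<close>.\<close>

lemma active_ascend:
  assumes "edge\<^sup>*\<^sup>* v y" "v \<notin> An \<Z>" "y \<in> wires \<phi>"
  shows "\<exists>ws. active \<phi> \<Z> v y ws \<and> open_start \<Z> ws"
  using assms(1,2)
proof (induction rule: converse_rtranclp_induct)
  case base
  have "active \<phi> \<Z> y y [y]" "open_start \<Z> [y]" using assms by simp_all
  then show ?case by blast
next
  case (step v u)
  from step.prems step(1) have "u \<notin> An \<Z>" by (blast intro: An_edge)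
  with step.IH obtain ws where ws: "active \<phi> \<Z> u y ws" "open_start \<Z> ws" by blast
  have "v \<notin> \<Z>" using step edge_wires An_base by blast
  then show ?case
    using active_parent open_start_parent ws step(1) by blast
qed

text \<open>The endpoints obtained may differ from the given ones, since the walk is redirected
  whenever a collider would block it.\<close>

lemma moral_imp_active:
  assumes path: "(moral (\<X> \<union> \<Y> \<union> \<Z>) \<Z>)\<^sup>*\<^sup>* x y" and "x \<in> \<X>" "y \<in> \<Y>"
    and wires: "\<X> \<subseteq> wires \<phi>" "\<Y> \<subseteq> wires \<phi>"
  shows "\<exists>x \<in> \<X>. \<exists>y \<in> \<Y>. \<exists>ws. active \<phi> \<Z> x y ws"
proof (rule ccontr)
  let ?S = "\<X> \<union> \<Y> \<union> \<Z>"
  let ?P = "\<lambda>v. \<exists>y \<in> \<Y>. \<exists>ws. active \<phi> \<Z> v y ws \<and> open_start \<Z> ws"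
  assume none: "\<not> ?thesis"
  \<comment> \<open>A moral step from \<open>v\<close> to \<open>u\<close> descends to a common wire
    \<open>w\<close> and then climbs to \<open>u\<close>. Descending is delicate, because climbing
    afterwards makes \<open>w\<close> a collider.\<close>
  have child: "?P w" if v: "?P v" "v \<notin> \<Z>" "v \<leadsto> w" "w \<in> An ?S" for v w
  proof -
    from v obtain y ws where y: "y \<in> \<Y>" and ws: "active \<phi> \<Z> v y ws" by blast
    have w: "active \<phi> \<Z> w y (w # ws)" using active_child ws v by blast
    show ?thesis
    proof (cases "w \<in> An \<Z>")
      case True
      moreover obtain us where "ws = v # us" using ws by (rule active_obtain)
      ultimately have "open_start \<Z> (w # ws)" using v(3) by simp
      then show ?thesis using w y by blast
    next
      case False
      from v(4) False obtain s where s: "s \<in> \<X> \<union> \<Y>" "edge\<^sup>*\<^sup>* w s"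
        by (auto simp: ancestors_def)
      \<comment> \<open>Descending from \<open>w\<close> to a wire of \<open>\<X>\<close> would
        already complete an active walk, contrary to \<open>none\<close>.\<close>
      have "s \<notin> \<X>" using active_descend[OF s(2) False w] none y by blast
      with s have "s \<in> \<Y>" by blast
      \<comment> \<open>The old walk is abandoned for the directed path from \<open>w\<close> to
        \<open>s\<close>, which becomes the new endpoint in \<open>\<Y>\<close>.\<close>
      then show ?thesis using active_ascend[OF s(2) False] wires by blast
    qed
  qed
  have parent: "?P u" if "?P w" "u \<leadsto> w" "u \<notin> \<Z>" for u w
    using that active_parent open_start_parent by blast
  from path have "?P x"
  proof (induction rule: converse_rtranclp_induct)
    case base
    have "active \<phi> \<Z> y y [y]" "open_start \<Z> [y]" using \<open>y \<in> \<Y>\<close> wires by auto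
    then show ?case using \<open>y \<in> \<Y>\<close> by blast
  next
    case (step u v)
    then obtain w where "w \<in> An ?S" "v = w \<or> v \<leadsto> w" "u = w \<or> u \<leadsto> w" "v \<notin> \<Z>" "u \<notin> \<Z>"
      by (auto simp: moral_def)
    moreover from this have "?P w" using child step.IH by blast
    ultimately show ?case using parent by blast
  qed
  then show False using none \<open>x \<in> \<X>\<close> by blast
qed

section \<open>From active walks to moral walks\<close>

text \<open>Following the outgoing edges leads either to the end \<open>y\<close> or to a first
  collider, which lies in \<open>An \<Z>\<close> because the walk is active.\<close>

lemma active_start_ancestor:
  assumes "active \<phi> \<Z> v y (v # ws)" "y \<in> \<S>" "\<Z> \<subseteq> \<S>" "ws \<noteq> [] \<Longrightarrow> v \<leadsto> hd ws"
  shows "v \<in> An \<S>"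
  using assms(1,4)
proof (induction ws arbitrary: v)
  case Nil
  then show ?case using assms(2) by (auto intro: An_base)
next
  case (Cons u ws)
  then have "v \<leadsto> u" and act: "active \<phi> \<Z> u y (u # ws)" by (auto simp: active_Cons)
  have "u \<in> An \<S>"
  proof (cases "ws \<noteq> [] \<and> hd ws \<leadsto> u")
    case True
    then have "u \<in> An \<Z>"
      using Cons.prems \<open>v \<leadsto> u\<close> by (auto simp: active_Cons separated_triple_def)
    then show ?thesis using An_mono assms(3) by blast
  next
    case False
    then have "u \<leadsto> hd ws" if "ws \<noteq> []"
      using act that by (cases ws) (auto simp: active_Cons)
    then show ?thesis using Cons.IH act by blast
  qed
  then show ?case using \<open>v \<leadsto> u\<close> by (rule An_edge[rotated])
qed

text \<open>Parents of ancestors are ancestors. A wire entered along an edge is an open collider, is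
  left along an outgoing edge, or ends the walk; the last two cases fall under
  \<open>active_start_ancestor\<close>.\<close>

lemma active_subset_ancestors:
  assumes "active \<phi> \<Z> v y (v # ws)" "y \<in> \<S>" "\<Z> \<subseteq> \<S>" "v \<in> An \<S>"
  shows "set ws \<subseteq> An \<S>"
  using assms(1,4)
proof (induction ws arbitrary: v)
  case Nil
  then show ?case by simp
next
  case (Cons u ws)
  then have act: "active \<phi> \<Z> u y (u # ws)" by (simp add: active_Cons)
  have "u \<in> An \<S>"
  proof (cases "u \<leadsto> v")
    case True
    then show ?thesis using Cons.prems by (blast intro: An_edge)
  next
    case False
    then have "v \<leadsto> u" using Cons.prems by (auto simp: active_Cons)
    show ?thesis
    proof (cases "ws \<noteq> [] \<and> hd ws \<leadsto> u")
      case True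
      then have "u \<in> An \<Z>"
        using Cons.prems \<open>v \<leadsto> u\<close> by (auto simp: active_Cons separated_triple_def)
      then show ?thesis using An_mono assms(3) by blast
    next
      case False
      then have "u \<leadsto> hd ws" if "ws \<noteq> []"
        using act that by (cases ws) (auto simp: active_Cons)
      then show ?thesis using active_start_ancestor[OF act assms(2,3)] by blast
    qed
  qed
  then show ?case using Cons.IH[OF act] by simp
qed

text \<open>On an active walk an inner wire in \<open>\<Z>\<close> is a collider, and its two
  neighbours are moral neighbours as parents of it. Skipping it shortens the walk by two wires,
  hence the induction on length.\<close>

lemma active_imp_moral:
  assumes "active \<phi> \<Z> v y (v # ws)" "y \<notin> \<Z>" "v \<notin> \<Z>" "set (v # ws) \<subseteq> An \<S>"
  shows "(moral \<S> \<Z>)\<^sup>*\<^sup>* v y"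
  using assms(1,3,4)
proof (induction ws arbitrary: v rule: length_induct)
  case (1 ws)
  show ?case
  proof (cases ws)
    case Nil
    then show ?thesis using 1 by simp
  next
    case (Cons u us)
    with 1 have edge: "v \<leadsto> u \<or> u \<leadsto> v" and act: "active \<phi> \<Z> u y (u # us)"
      and sub: "v \<in> An \<S>" "u \<in> An \<S>" "set us \<subseteq> An \<S>" by (auto simp: active_Cons)
    show ?thesis
    proof (cases "u \<in> \<Z>")
      case False
      then have "moral \<S> \<Z> v u" using edge sub 1 by (auto simp: moral_def)
      moreover have "(moral \<S> \<Z>)\<^sup>*\<^sup>* u y" using 1(1) Cons act False sub by auto
      ultimately show ?thesis by (rule converse_rtranclp_into_rtranclp)
    next
      case True
      then have "us \<noteq> []" using act assms(2) by (auto dest: active_hd)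
      then obtain w rest where us: "us = w # rest" by (cases us) auto
      have triple: "\<not> separated_triple \<phi> \<Z> v u w"
        using 1 Cons us by (simp add: active_Cons)
      have wact: "active \<phi> \<Z> w y (w # rest)" and "u \<leadsto> w \<or> w \<leadsto> u"
        using act us by (auto simp: active_Cons)
      with triple True edge have col: "v \<leadsto> u" "w \<leadsto> u"
        by (auto simp: separated_triple_def)
      \<comment> \<open>The edge from \<open>w\<close> to \<open>u\<close> leaves \<open>w\<close>,
        so \<open>w\<close> is no collider on the walk: it is either the end \<open>y\<close> or an
        inner wire that \<open>\<Z>\<close> would block.\<close>
      have "w \<notin> \<Z>"
      proof (cases rest)
        case Nil
        then show ?thesis using wact assms(2) by auto
      next
        case (Cons t rest')
        then show ?thesis using act us col wact
          by (auto simp: active_Cons separated_triple_def)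
      qed
      then have "moral \<S> \<Z> v w" using col sub us 1 by (auto simp: moral_def)
      moreover have "(moral \<S> \<Z>)\<^sup>*\<^sup>* w y"
        using 1(1)[rule_format, of rest w] Cons us wact \<open>w \<notin> \<Z>\<close> sub by simp
      ultimately show ?thesis by (rule converse_rtranclp_into_rtranclp)
    qed
  qed
qed

section \<open>Equivalence of the two notions\<close>

lemma cat_d_separates_iff_classical:
  assumes "\<X> \<subseteq> wires \<phi>" "\<Y> \<subseteq> wires \<phi>" "\<X> \<inter> \<Z> = {}" "\<Y> \<inter> \<Z> = {}"
  shows "cat_d_separates \<phi> \<Z> \<X> \<Y> \<longleftrightarrow> classical_d_separated \<phi> \<X> \<Y> \<Z>"
proof -
  let ?S = "\<X> \<union> \<Y> \<union> \<Z>"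
  \<comment> \<open>This direction keeps the endpoints. The converse may change them, so the two
    notions are compared only after quantifying over all of \<open>\<X>\<close> and
    \<open>\<Y>\<close>.\<close>
  have moral: "x \<in> An ?S - \<Z> \<and> (moral ?S \<Z>)\<^sup>*\<^sup>* x y"
    if xy: "x \<in> \<X>" "y \<in> \<Y>" and act: "active \<phi> \<Z> x y ws" for x y ws
  proof -
    obtain us where "ws = x # us" using act by (rule active_obtain)
    moreover have "x \<in> An ?S" using xy assms by (auto intro: An_base)
    ultimately show ?thesis
      using xy act assms active_subset_ancestors[of \<Z> x y us ?S] active_imp_moral[of \<Z> x y us ?S]
      by auto
  qed
  have "classical_d_separated \<phi> \<X> \<Y> \<Z> \<longleftrightarrow> \<not> (\<exists>x \<in> \<X>. \<exists>y \<in> \<Y>. \<exists>ws. active \<phi> \<Z> x y ws)"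
    by (auto simp: classical_d_separated_def active_def)
  then show ?thesis
    unfolding cat_d_separates_iff using moral moral_imp_active[of \<X> \<Y> \<Z>] assms(1,2) by blast
qed

end

lemma single_output_modelI:
  assumes "pure_bloom \<Sigma> \<phi>" "in_wires \<phi> = {}" "\<forall>b \<in> boxes \<phi>. length (outs \<phi> b) = 1"
  shows "single_output_model \<phi>"
proof
  from assms(1) have gs: "gs_diagram \<Sigma> \<phi>" and out: "out_wires \<phi> = wires \<phi>"
    by (auto simp: pure_bloom_def causal_model_def)
  then show "finite_hypergraph \<phi>" "acyclic_hypergraph \<phi>" "out_wires \<phi> = wires \<phi>"
    by (auto simp: gs_diagram_def)
  show "length (outs \<phi> b) = 1" if "b \<in> boxes \<phi>" for b using assms(3) that by blast
  fix w assume "w \<in> wires \<phi>"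
  then have "(\<Sum>b \<in> boxes \<phi>. out_mult \<phi> b w) = 1"
    using gs assms(2) by (simp add: gs_diagram_def left_monogamous_def in_wires_def)
  moreover have "finite (boxes \<phi>)" using gs by (simp add: gs_diagram_def finite_hypergraph_def)
  \<comment> \<open>A finite sum of natural numbers equals one only if a single summand is one and
    the others vanish; that summand belongs to the producer of \<open>w\<close>.\<close>
  ultimately obtain b where b: "b \<in> boxes \<phi>" "out_mult \<phi> b w = 1"
    "\<forall>c \<in> boxes \<phi>. b \<noteq> c \<longrightarrow> out_mult \<phi> c w = 0"
    by (auto simp: sum_eq_1_iff simp del: One_nat_def)
  then show "\<exists>!b. b \<in> boxes \<phi> \<and> w \<in> set (outs \<phi> b)"
    by (intro ex1I[of _ b]) (auto simp: out_mult_def count_list_0_iff intro: ccontr)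
qed

theorem proposition28:
  fixes \<Sigma> :: "('s, 't) pre_hypergraph"
    and \<phi> :: "('w, 'b, 's, 't) pre_diagram"
    and \<X> \<Y> \<Z> :: "'w set"
  assumes "hypergraph \<Sigma>"
    and "pure_bloom \<Sigma> \<phi>"
    and "in_wires \<phi> = {}"
    and "\<forall>b \<in> boxes \<phi>. length (outs \<phi> b) = 1"
    and "\<X> \<subseteq> out_wires \<phi>" and "\<Y> \<subseteq> out_wires \<phi>" and "\<Z> \<subseteq> out_wires \<phi>"
    and "\<X> \<inter> \<Y> = {}" and "\<X> \<inter> \<Z> = {}" and "\<Y> \<inter> \<Z> = {}"
  shows "cat_d_separates \<phi> \<Z> \<X> \<Y> \<longleftrightarrow> classical_d_separated \<phi> \<X> \<Y> \<Z>"
  using single_output_model.cat_d_separates_iff_classical[OF single_output_modelI] assms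
  by (metis pure_bloom_def)

end
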